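(* Let $\Phi$ be a phi-irreducible and aperiodic Markov chain on $\mathsf{X}$ with transition kernel $P$. Suppose that there exist a small set $\mathcal{C}$, a constant $b<\infty$, a measurable function $V : \mathsf{X} \to [1,\infty)$ and a continuously differentiable increasing concave function $\phi : [1,\infty) \to (0, \infty)$, such that $$PV \leq V - \phi \circ V + b\, \mathbf{1}_{\mathcal{C}}, \qquad \sup_{\mathcal{C}} V < \infty, \qquad \inf_{[1,\infty)} \phi >0,$$ and that $\phi(t)\sim c\, t^{1-\alpha}$ as $t\to\infty$ for some $c>0$ and some $\alpha \in (0,1/2)$. Then $\Phi$ is tame.
   Context: $Pf(x)=\int P(x,dy)f(y)$; $\mathbb{E}_x$ is expectation for the chain started at $x$; $\mathbf{1}_{\mathcal{C}}$ is the indicator function. A measurable set $\mathcal{C}$ is small if there exist an integer $m\ge 1$, a non-trivial measure $\nu$ and $\varepsilon>0$ with $P^m(x,\cdot)\ge\varepsilon\nu(\cdot)$ for all $x\in\mathcal{C}$. Definition (tame). The chain $\Phi$ is tame if there exist a function $W:\mathsf{X}\to[1,\infty)$, a small set $\mathcal{C}'$, and constants $\beta\in(0,1)$, $b'<\infty$ such that the following two conditions hold: (i) there exist $\delta\in(0,1)$ and a deterministic function $n:\mathsf{X}\to\mathbb{N}$ satisfying $n(x) \leq W^\delta(x)$ for all $x$, such that $\mathbb{E}_x\left[ W(\Phi_{n(x)}) \right] \leq \beta W(x) + b'\, \mathbf{1}_{\mathcal{C}'}(x)$ for all $x\in\mathsf{X}$; (ii) the constant $\delta$ in (i) satisfies $\ln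 \beta < \delta^{-1}\ln (1-\delta)$. *)

theory Defs
  imports "HOL-Probability.Probability" "HOL-Library.Landau_Symbols"
begin

fun kernel_pow :: "'a measure \<Rightarrow> ('a \<Rightarrow> 'a measure) \<Rightarrow> nat \<Rightarrow> 'a \<Rightarrow> 'a measure" where
  "kernel_pow M P 0 x = return M x"
| "kernel_pow M P (Suc n) x = P x \<bind> kernel_pow M P n"

definition history :: "'a measure \<Rightarrow> 'w measure \<Rightarrow> (nat \<Rightarrow> 'w \<Rightarrow> 'a) \<Rightarrow> nat \<Rightarrow> 'w measure" where
  "history M Q \<Phi> n =
     vimage_algebra (space Q) (\<lambda>\<omega>. \<lambda>i\<in>{..n}. \<Phi> i \<omega>) (PiM {..n} (\<lambda>_. M))"

text \<open>
  The state space is the measurable space \<open>M\<close> (only its carrier and sigma-algebra matter), and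
  \<open>Pr x\<close> is the law under which the chain is started at \<open>x\<close>. The underlying probability space is
  arbitrary and may depend on \<open>x\<close>. The initial condition is stated through the law
  of \<open>\<Phi> 0\<close>, since the singleton of \<open>x\<close> need not be measurable.
\<close>

locale markov_chain =
  fixes M :: "'a measure" and P :: "'a \<Rightarrow> 'a measure"
    and Pr :: "'a \<Rightarrow> 'w measure" and \<Phi> :: "nat \<Rightarrow> 'w \<Rightarrow> 'a"
  assumes kernel: "P \<in> M \<rightarrow>\<^sub>M prob_algebra M"
    and prob: "\<And>x. x \<in> space M \<Longrightarrow> prob_space (Pr x)"
    and meas: "\<And>x n. x \<in> space M \<Longrightarrow> \<Phi> n \<in> Pr x \<rightarrow>\<^sub>M M"
    and start: "\<And>x. x \<in> space M \<Longrightarrow> distr (Pr x) M (\<Phi> 0) = return M x"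
    and markov: "\<And>x n A. x \<in> space M \<Longrightarrow> A \<in> sets M \<Longrightarrow>
      AE \<omega> in Pr x.
        real_cond_exp (Pr x) (history M (Pr x) \<Phi> n)
          (indicator (\<Phi> (Suc n) -` A \<inter> space (Pr x))) \<omega> = measure (P (\<Phi> n \<omega>)) A"

definition small_set :: "'a measure \<Rightarrow> ('a \<Rightarrow> 'a measure) \<Rightarrow> 'a set \<Rightarrow> bool" where
  "small_set M P C \<longleftrightarrow> C \<in> sets M \<and>
     (\<exists>(m::nat) (\<nu>::'a measure) (\<epsilon>::real).
        m \<ge> 1 \<and> sets \<nu> = sets M \<and> emeasure \<nu> (space M) > 0 \<and> \<epsilon> > 0 \<and>
        (\<forall>x\<in>C. \<forall>A\<in>sets M. emeasure (kernel_pow M P m x) A \<ge> ennreal \<epsilon> * emeasure \<nu> A))"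

text \<open>
  Irreducibility and periodicity are those of Meyn and Tweedie, \<^emph>\<open>Markov Chains and Stochastic
  Stability\<close>: sets of positive irreducibility measure are reached at some time at least one with
  positive probability from every starting point, and the period is the largest length of a cycle
  whose classes exhaust the state space up to a null set of a maximal irreducibility measure.
\<close>

definition irreducibility_measure ::
  "'a measure \<Rightarrow> ('a \<Rightarrow> 'w measure) \<Rightarrow> (nat \<Rightarrow> 'w \<Rightarrow> 'a) \<Rightarrow> 'a measure \<Rightarrow> bool" where
  "irreducibility_measure M Pr \<Phi> \<mu> \<longleftrightarrow>
     sets \<mu> = sets M \<and> emeasure \<mu> (space M) > 0 \<and>
     (\<forall>A\<in>sets M. emeasure \<mu> A > 0 \<longrightarrow>
        (\<forall>x\<in>space M. measure (Pr x) {\<omega>\<in>space (Pr x). \<exists>k\<ge>1. \<Phi> k \<omega> \<in> A} > 0))"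

definition phi_irreducible ::
  "'a measure \<Rightarrow> ('a \<Rightarrow> 'w measure) \<Rightarrow> (nat \<Rightarrow> 'w \<Rightarrow> 'a) \<Rightarrow> bool" where
  "phi_irreducible M Pr \<Phi> \<longleftrightarrow> (\<exists>\<mu>. irreducibility_measure M Pr \<Phi> \<mu>)"

definition maximal_irreducibility_measure ::
  "'a measure \<Rightarrow> ('a \<Rightarrow> 'w measure) \<Rightarrow> (nat \<Rightarrow> 'w \<Rightarrow> 'a) \<Rightarrow> 'a measure \<Rightarrow> bool" where
  "maximal_irreducibility_measure M Pr \<Phi> \<psi> \<longleftrightarrow>
     irreducibility_measure M Pr \<Phi> \<psi> \<and>
     (\<forall>\<mu>. irreducibility_measure M Pr \<Phi> \<mu> \<longrightarrow> absolutely_continuous \<psi> \<mu>)"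

definition is_cycle ::
  "'a measure \<Rightarrow> ('a \<Rightarrow> 'a measure) \<Rightarrow> 'a measure \<Rightarrow> nat \<Rightarrow> (nat \<Rightarrow> 'a set) \<Rightarrow> bool" where
  "is_cycle M P \<psi> d D \<longleftrightarrow>
     d \<ge> 1 \<and> (\<forall>i<d. D i \<in> sets M) \<and> disjoint_family_on D {..<d} \<and>
     (\<forall>i<d. \<forall>x\<in>D i. emeasure (P x) (D (Suc i mod d)) = 1) \<and>
     space M - (\<Union>i<d. D i) \<in> null_sets \<psi>"

definition aperiodic ::
  "'a measure \<Rightarrow> ('a \<Rightarrow> 'a measure) \<Rightarrow> ('a \<Rightarrow> 'w measure) \<Rightarrow> (nat \<Rightarrow> 'w \<Rightarrow> 'a) \<Rightarrow> bool" where
  "aperiodic M P Pr \<Phi> \<longleftrightarrow>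
     (\<forall>\<psi> d D. maximal_irreducibility_measure M Pr \<Phi> \<psi> \<longrightarrow> is_cycle M P \<psi> d D \<longrightarrow> d = 1)"

text \<open>
  Expectations of the functions \<open>W \<ge> 1\<close> are nonnegative integrals, so that the inequality also
  asserts finiteness; as the left-hand side is at least 1, the truncation of \<^const>\<open>ennreal\<close> at
  0 is harmless even if \<open>b'\<close> is negative. Sampling times are positive.
\<close>

definition tame ::
  "'a measure \<Rightarrow> ('a \<Rightarrow> 'a measure) \<Rightarrow> ('a \<Rightarrow> 'w measure) \<Rightarrow> (nat \<Rightarrow> 'w \<Rightarrow> 'a) \<Rightarrow> bool" where
  "tame M P Pr \<Phi> \<longleftrightarrow>
     (\<exists>(W::'a \<Rightarrow> real) C' (\<beta>::real) (b'::real).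
        W \<in> borel_measurable M \<and> (\<forall>x\<in>space M. W x \<ge> 1) \<and> small_set M P C' \<and> 0 < \<beta> \<and> \<beta> < 1 \<and>
        (\<exists>(\<delta>::real) (n::'a \<Rightarrow> nat).
           0 < \<delta> \<and> \<delta> < 1 \<and>
           (\<forall>x\<in>space M. n x \<ge> 1 \<and> real (n x) \<le> W x powr \<delta>) \<and>
           (\<forall>x\<in>space M. (\<integral>\<^sup>+ \<omega>. ennreal (W (\<Phi> (n x) \<omega>)) \<partial>Pr x)
              \<le> ennreal (\<beta> * W x + b' * indicator C' x)) \<and>
           ln \<beta> < (1 / \<delta>) * ln (1 - \<delta>)))"

end

theory Submission
  imports Defs "HOL-Number_Theory.Cong" "HOL-Real_Asymp.Real_Asymp"
begin

text \<open>
  Put \<open>\<eta> = 1 - \<alpha> > 1/2\<close> and \<open>W = V\<^sup>\<eta>\<close>, so that \<open>\<phi> \<circ> V \<ge> c' W\<close>. Summing the drift inequality over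
  times up to \<open>n\<close> bounds the sum of the expectations of \<open>c' W(\<Phi>\<^sub>k)\<close> by \<open>V(x) + b (n + 1)\<close>; hence
  some deterministic time \<open>k\<close> between 1 and \<open>n = \<lfloor>\<surd>V(x)\<rfloor>\<close> has \<open>E\<^sub>x W(\<Phi>\<^sub>k) = O(\<surd>V(x)) = o(W(x))\<close>.
  So \<open>\<delta> = 1/(2\<eta>) < 1\<close> works with every \<open>\<beta> > 0\<close>, outside a sublevel set of \<open>V\<close>.

  Sublevel sets of \<open>V\<close> are small: the same summed inequality shows that \<open>C\<close> is charged by \<open>P\<^sup>k(x,\<cdot>)\<close>
  for some \<open>k < N\<close>, uniformly over the sublevel set, and by aperiodicity \<open>C\<close> satisfies a minorization
  with the same measure \<open>\<nu>\<close> at all large times. The latter holds because the minorization times,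
  shifted by a constant, form an additive semigroup whose gcd is the length of a cycle.
\<close>

section \<open>Iterates of a Markov kernel\<close>

locale markov_kernel =
  fixes M :: "'a measure" and P :: "'a \<Rightarrow> 'a measure"
  assumes kernel_measurable: "P \<in> M \<rightarrow>\<^sub>M prob_algebra M"
begin

lemma measurable_P [measurable]: "P \<in> M \<rightarrow>\<^sub>M subprob_algebra M"
  using kernel_measurable by (rule measurable_prob_algebraD)

lemma measurable_kernel_pow [measurable]: "kernel_pow M P n \<in> M \<rightarrow>\<^sub>M prob_algebra M"
proof (induction n)
  case 0
  show ?case by (simp add: measurable_return_prob_space[unfolded id_def] cong: measurable_cong)
next
  case (Suc n)
  have "kernel_pow M P (Suc n) = (\<lambda>x. P x \<bind> kernel_pow M P n)"
    by auto
  then show ?case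
    using measurable_bind_prob_space[OF kernel_measurable Suc] by simp
qed

lemma measurable_kernel_pow_subprob [measurable]:
  "kernel_pow M P n \<in> M \<rightarrow>\<^sub>M subprob_algebra M"
  using measurable_kernel_pow by (rule measurable_prob_algebraD)

lemma prob_space_kernel_pow: "x \<in> space M \<Longrightarrow> prob_space (kernel_pow M P n x)"
  and sets_kernel_pow [measurable_cong]: "x \<in> space M \<Longrightarrow> sets (kernel_pow M P n x) = sets M"
  using measurable_space[OF measurable_kernel_pow] by (auto simp: space_prob_algebra)

lemma space_kernel_pow: "x \<in> space M \<Longrightarrow> space (kernel_pow M P n x) = space M"
  by (rule sets_eq_imp_space_eq) (rule sets_kernel_pow)

lemma prob_space_P: "x \<in> space M \<Longrightarrow> prob_space (P x)"
  and sets_P [measurable_cong]: "x \<in> space M \<Longrightarrow> sets (P x) = sets M"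
  using measurable_space[OF kernel_measurable] by (auto simp: space_prob_algebra)

lemma space_P: "x \<in> space M \<Longrightarrow> space (P x) = space M"
  by (rule sets_eq_imp_space_eq) (rule sets_P)

lemma kernel_pow_add:
  assumes "x \<in> space M"
  shows "kernel_pow M P (m + n) x = kernel_pow M P m x \<bind> kernel_pow M P n"
  using assms
proof (induction m arbitrary: x)
  case 0
  then show ?case by (simp add: bind_return[OF measurable_kernel_pow_subprob])
next
  case (Suc m)
  have "kernel_pow M P (Suc m + n) x = P x \<bind> (\<lambda>y. kernel_pow M P m y \<bind> kernel_pow M P n)"
    using Suc by (auto intro!: bind_cong simp: space_P)
  also have "\<dots> = kernel_pow M P (Suc m) x \<bind> kernel_pow M P n"
  proof -
    have "kernel_pow M P m \<in> P x \<rightarrow>\<^sub>M subprob_algebra M"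
      using Suc.prems by (simp add: sets_P cong: measurable_cong_sets)
    from bind_assoc[OF this measurable_kernel_pow_subprob] show ?thesis by simp
  qed
  finally show ?case .
qed

lemma nn_integral_kernel_pow_add:
  assumes "x \<in> space M" "f \<in> borel_measurable M"
  shows "(\<integral>\<^sup>+z. f z \<partial>kernel_pow M P (m + n) x) =
    (\<integral>\<^sup>+y. (\<integral>\<^sup>+z. f z \<partial>kernel_pow M P n y) \<partial>kernel_pow M P m x)"
  unfolding kernel_pow_add[OF assms(1)]
  by (rule nn_integral_bind[OF assms(2)])
    (use assms in \<open>simp add: sets_kernel_pow cong: measurable_cong_sets\<close>)

lemma kernel_pow_1: "x \<in> space M \<Longrightarrow> kernel_pow M P (Suc 0) x = P x"
  using bind_return'[of "P x"] return_sets_cong[OF sets_P, of x]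
  by (auto simp: fun_eq_iff cong: bind_cong)

lemma nn_integral_kernel_pow_Suc:
  assumes "x \<in> space M" "f \<in> borel_measurable M"
  shows "(\<integral>\<^sup>+z. f z \<partial>kernel_pow M P (Suc n) x) =
    (\<integral>\<^sup>+y. (\<integral>\<^sup>+z. f z \<partial>P y) \<partial>kernel_pow M P n x)"
  using nn_integral_kernel_pow_add[OF assms, of n "Suc 0"] assms
  by (auto simp: space_kernel_pow kernel_pow_1 simp del: kernel_pow.simps intro!: nn_integral_cong)

lemma emeasure_kernel_pow_add:
  assumes "x \<in> space M" "A \<in> sets M"
  shows "emeasure (kernel_pow M P (m + n) x) A =
    (\<integral>\<^sup>+y. emeasure (kernel_pow M P n y) A \<partial>kernel_pow M P m x)"
  unfolding kernel_pow_add[OF assms(1)]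
  by (rule emeasure_bind)
    (use assms in \<open>auto simp: sets_kernel_pow space_kernel_pow cong: measurable_cong_sets\<close>)

lemma measurable_emeasure_kernel_pow [measurable]:
  "A \<in> sets M \<Longrightarrow> (\<lambda>y. emeasure (kernel_pow M P n y) A) \<in> borel_measurable M"
  by (rule measurable_emeasure_kernel[OF measurable_kernel_pow_subprob])

text \<open>Chapman-Kolmogorov, keeping only the trajectories that are in \<open>C\<close> at time
  \<open>m\<close>. All chaining of hitting and minorization estimates goes through this
  bound.\<close>

lemma emeasure_kernel_pow_add_ge:
  assumes "x \<in> space M" "A \<in> sets M" "C \<in> sets M"
    and "\<And>y. y \<in> C \<Longrightarrow> emeasure (kernel_pow M P n y) A \<ge> r"
  shows "emeasure (kernel_pow M P (m + n) x) A \<ge> emeasure (kernel_pow M P m x) C * r"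
proof -
  have "emeasure (kernel_pow M P m x) C * r = (\<integral>\<^sup>+y. r * indicator C y \<partial>kernel_pow M P m x)"
    using assms by (simp add: nn_integral_cmult_indicator sets_kernel_pow mult.commute)
  also have "\<dots> \<le> (\<integral>\<^sup>+y. emeasure (kernel_pow M P n y) A \<partial>kernel_pow M P m x)"
    using assms by (intro nn_integral_mono) (auto split: split_indicator)
  finally show ?thesis
    using assms by (simp add: emeasure_kernel_pow_add)
qed

text \<open>If \<open>C\<close> is missed at time \<open>Suc n\<close> from \<open>x\<close>, the
  hitting probabilities at time \<open>n\<close> integrate to 0 over \<open>P x\<close> and so
  vanish almost everywhere. Discarding countably many null sets puts the quantifier over
  \<open>n\<close> inside, so that several hitting times of one successor \<open>y\<close> can be
  compared.\<close>

lemma AE_P_hits: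
  assumes x: "x \<in> space M" and C: "C \<in> sets M"
  shows "AE y in P x. \<forall>n. emeasure (kernel_pow M P n y) C > 0 \<longrightarrow>
    emeasure (kernel_pow M P (Suc n) x) C > 0"
proof (subst AE_all_countable, rule)
  fix n
  have m: "(\<lambda>y. emeasure (kernel_pow M P n y) C) \<in> borel_measurable (P x)"
    using x C by (simp add: sets_P cong: measurable_cong_sets)
  have eq: "emeasure (kernel_pow M P (Suc n) x) C = (\<integral>\<^sup>+y. emeasure (kernel_pow M P n y) C \<partial>P x)"
    using emeasure_kernel_pow_add[OF x C, of "Suc 0" n] x kernel_pow_1[OF x]
    by (simp del: kernel_pow.simps)
  show "AE y in P x. emeasure (kernel_pow M P n y) C > 0 \<longrightarrow>
    emeasure (kernel_pow M P (Suc n) x) C > 0"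
  proof (cases "emeasure (kernel_pow M P (Suc n) x) C = 0")
    case True
    then show ?thesis
      unfolding eq nn_integral_0_iff_AE[OF m] by (rule eventually_mono) auto
  qed (auto simp: zero_less_iff_neq_zero)
qed

end

section \<open>Additive sets of natural numbers\<close>

text \<open>The witness \<open>d\<close> is the least positive difference of two elements of \<open>S\<close>.\<close>

lemma additive_set_gcd:
  fixes S :: "nat set"
  assumes add: "\<And>a b. a \<in> S \<Longrightarrow> b \<in> S \<Longrightarrow> a + b \<in> S"
    and pos: "m \<in> S" "m > 0"
  obtains d where "d > 0" "\<And>s. s \<in> S \<Longrightarrow> d dvd s" "d = 1 \<Longrightarrow> \<exists>n0. \<forall>n\<ge>n0. n \<in> S"
proof -
  have mult: "k * a \<in> S" if "a \<in> S" "k > 0" for k a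
    using that(2) by (induction k rule: nat_induct_non_zero) (auto simp: that add)
  define D where "D = (\<lambda>d. d > 0 \<and> (\<exists>a\<in>S. a + d \<in> S))"
  define d where "d = (LEAST d. D d)"
  have "D m" using pos add by (auto simp: D_def)
  then have d: "D d" unfolding d_def by (rule LeastI)
  have least: "d \<le> e" if "D e" for e
    unfolding d_def using that by (rule Least_le)
  obtain a where a: "a \<in> S" "a + d \<in> S" "d > 0" using d by (auto simp: D_def)
  show ?thesis
  proof (rule that)
    show "d > 0" by (fact a)
    show "d dvd e" if e: "e \<in> S" for e
    proof (rule ccontr)
      assume "\<not> d dvd e"
      then have r: "e mod d > 0" "e mod d < d" using a by (auto simp: dvd_eq_mod_eq_0)
      define q where "q = e div d"
      have e_eq: "e = q * d + e mod d" by (simp add: q_def)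
      \<comment> \<open>The elements \<open>q * (a + d)\<close> and \<open>q * a + e\<close> of
        \<open>S\<close> differ by the remainder, which is smaller than \<open>d\<close>. For
        \<open>q = 0\<close> these multiples may leave \<open>S\<close>, but then \<open>e\<close>
        is its own remainder and is the difference of \<open>e + e\<close> and
        \<open>e\<close>.\<close>
      have "D (e mod d)"
      proof (cases "q = 0")
        case True
        with e_eq e add[OF e e] r show ?thesis unfolding D_def by (metis add_0 mult_0)
      next
        case False
        then have 1: "q * (a + d) \<in> S" "q * a + e \<in> S" using mult a e add by auto
        have "q * a + e = q * (a + d) + e mod d" by (subst e_eq) (simp add: algebra_simps)
        with 1 r show ?thesis unfolding D_def by metis
      qed
      from least[OF this] r show False by simp
    qed
    show "\<exists>n0. \<forall>n\<ge>n0. n \<in> S" if "d = 1"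
    proof (cases "a = 0")
      case True
      with a \<open>d = 1\<close> have "1 \<in> S" by simp
      then have "\<forall>n\<ge>1. n \<in> S" using mult[of 1] by auto
      then show ?thesis ..
    next
      case False
      show ?thesis
      proof (intro exI allI impI)
        \<comment> \<open>From \<open>a * a\<close> on, the quotient is at least \<open>a\<close>
          and thus exceeds the remainder \<open>r\<close>. So \<open>r\<close> of the
          \<open>q\<close> copies of \<open>a\<close> can be replaced by \<open>a + 1\<close>,
          leaving at least one copy of \<open>a\<close>.\<close>
        fix n assume n: "n \<ge> a * a"
        define q r where "q = n div a" and "r = n mod a"
        have r: "r < a" and q: "a \<le> q" using False n
          by (auto simp: r_def q_def less_eq_div_iff_mult_less_eq)
        have "n = q * a + r" by (simp add: q_def r_def)
        also have "\<dots> = (q - r) * a + r * (a + 1)"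
          using r q by (simp add: algebra_simps flip: add_mult_distrib)
        finally have n_eq: "n = (q - r) * a + r * (a + 1)" .
        have "(q - r) * a \<in> S" using a r q by (intro mult) auto
        moreover have "r * (a + 1) \<in> S" if "r > 0" using a that \<open>d = 1\<close> by (intro mult) auto
        ultimately show "n \<in> S" using n_eq add by (cases "r = 0") auto
      qed
    qed
  qed
qed

section \<open>Laws and hitting probabilities of the chain\<close>

lemma (in markov_chain) markov_kernel: "markov_kernel M P"
  by unfold_locales (rule kernel)

text \<open>Integrating the conditional probability of the next step removes the conditioning on the
  history, which leaves the integral of \<open>P\<close> against the law at time
  \<open>n\<close>.\<close>

lemma (in markov_chain) distr_eq_kernel_pow:
  assumes x: "x \<in> space M"
  shows "distr (Pr x) M (\<Phi> n) = kernel_pow M P n x"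
proof (induction n)
  case 0
  then show ?case using x by (simp add: start)
next
  case (Suc n)
  interpret K: markov_kernel M P by (rule markov_kernel)
  interpret prob_space "Pr x" using x by (rule prob)
  note [measurable] = meas[OF x]
  have "sets (history M (Pr x) \<Phi> n) \<subseteq> sets (Pr x)"
    unfolding history_def
    by (rule sets_image_in_sets) (auto intro: measurable_restrict meas[OF x])
  then have "subalgebra (Pr x) (history M (Pr x) \<Phi> n)"
    by (simp add: subalgebra_def history_def)
  then interpret finite_measure_subalgebra "Pr x" "history M (Pr x) \<Phi> n"
    by unfold_locales
  show ?case
  proof (rule measure_eqI)
    fix A assume "A \<in> sets (distr (Pr x) M (\<Phi> (Suc n)))"
    then have A [measurable]: "A \<in> sets M" by simp
    have m: "(\<lambda>y. measure (P y) A) \<in> borel_measurable M"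
      by (rule measurable_compose[OF K.measurable_P measurable_measure_subprob_algebra[OF A]])
    let ?I = "indicator (\<Phi> (Suc n) -` A \<inter> space (Pr x)) :: 'w \<Rightarrow> real"
    have "measure (Pr x) (\<Phi> (Suc n) -` A \<inter> space (Pr x)) = (\<integral>\<omega>. ?I \<omega> \<partial>Pr x)"
      by simp
    also have "\<dots> = (\<integral>\<omega>. real_cond_exp (Pr x) (history M (Pr x) \<Phi> n) ?I \<omega> \<partial>Pr x)"
      by (intro real_cond_exp_int(2)[symmetric] integrable_real_indicator) (auto simp: less_top[symmetric])
    also have "\<dots> = (\<integral>\<omega>. measure (P (\<Phi> n \<omega>)) A \<partial>Pr x)"
      using markov[OF x A, of n] measurable_compose[OF meas[OF x] m]
      by (intro integral_cong_AE) auto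
    also have "\<dots> = (\<integral>y. measure (P y) A \<partial>kernel_pow M P n x)"
      unfolding Suc[symmetric] using m by (intro integral_distr[symmetric]) auto
    finally have "emeasure (Pr x) (\<Phi> (Suc n) -` A \<inter> space (Pr x)) =
        ennreal (\<integral>y. measure (P y) A \<partial>kernel_pow M P n x)"
      by (simp add: emeasure_eq_measure)
    also have "\<dots> = (\<integral>\<^sup>+y. ennreal (measure (P y) A) \<partial>kernel_pow M P n x)"
    proof (intro nn_integral_eq_integral[symmetric])
      interpret L: prob_space "kernel_pow M P n x" using x by (rule K.prob_space_kernel_pow)
      show "integrable (kernel_pow M P n x) (\<lambda>y. measure (P y) A)"
        using m x K.prob_space_P
        by (intro L.integrable_const_bound[where B = 1])
          (auto simp: K.sets_kernel_pow K.space_kernel_pow prob_space.prob_le_1 cong: measurable_cong_sets)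
    qed auto
    also have "\<dots> = (\<integral>\<^sup>+y. emeasure (kernel_pow M P 1 y) A \<partial>kernel_pow M P n x)"
      using x
      by (auto intro!: nn_integral_cong simp: K.kernel_pow_1 K.space_kernel_pow
          finite_measure.emeasure_eq_measure[OF prob_space.finite_measure[OF K.prob_space_P]]
          simp del: kernel_pow.simps)
    also have "\<dots> = emeasure (kernel_pow M P (Suc n) x) A"
      using K.emeasure_kernel_pow_add[OF x A, of n 1] by (simp del: kernel_pow.simps)
    finally show "emeasure (distr (Pr x) M (\<Phi> (Suc n))) A = emeasure (kernel_pow M P (Suc n) x) A"
      by (simp add: emeasure_distr)
  qed (simp only: sets_distr K.sets_kernel_pow[OF x])
qed

lemma (in markov_chain) emeasure_hitting:
  assumes x: "x \<in> space M" and A: "A \<in> sets M"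
  shows "emeasure (Pr x) {\<omega>\<in>space (Pr x). \<Phi> k \<omega> \<in> A} = emeasure (kernel_pow M P k x) A"
proof -
  have "{\<omega>\<in>space (Pr x). \<Phi> k \<omega> \<in> A} = \<Phi> k -` A \<inter> space (Pr x)"
    by auto
  then show ?thesis
    unfolding distr_eq_kernel_pow[OF x, symmetric] using meas[OF x] A by (simp add: emeasure_distr)
qed

text \<open>A countable union of events is null iff each of them is. This turns irreducibility into
  a statement about iterates of the kernel.\<close>

lemma (in markov_chain) hits_iff:
  assumes x: "x \<in> space M" and A: "A \<in> sets M"
  shows "measure (Pr x) {\<omega>\<in>space (Pr x). \<exists>k\<ge>1. \<Phi> k \<omega> \<in> A} > 0 \<longleftrightarrow>
    (\<exists>k\<ge>1. emeasure (kernel_pow M P k x) A > 0)"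
proof -
  interpret prob_space "Pr x" using x by (rule prob)
  note [measurable] = meas[OF x] A
  have "measure (Pr x) {\<omega>\<in>space (Pr x). \<exists>k\<ge>1. \<Phi> k \<omega> \<in> A} = 0 \<longleftrightarrow>
      (AE \<omega> in Pr x. \<forall>k. k \<ge> 1 \<longrightarrow> \<Phi> k \<omega> \<notin> A)"
    by (subst prob_eq_0) (auto intro!: arg_cong[where f = "\<lambda>f. eventually f (ae_filter (Pr x))"])
  also have "\<dots> \<longleftrightarrow> (\<forall>k\<ge>1. AE \<omega> in Pr x. \<Phi> k \<omega> \<notin> A)"
    by (simp add: AE_all_countable)
  also have "\<dots> \<longleftrightarrow> (\<forall>k\<ge>1. emeasure (kernel_pow M P k x) A = 0)"
    by (simp add: emeasure_hitting[OF x A, symmetric] AE_iff_measurable[OF _ refl])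
  finally show ?thesis
    by (auto simp: zero_less_iff_neq_zero less_le measure_nonneg)
qed

section \<open>Minorization times\<close>

context markov_kernel
begin

text \<open>The measure is a parameter while the constant may depend on the time: minorizations at
  different times can be combined only if they share \<open>\<nu>\<close>.\<close>

definition minorizes :: "'a set \<Rightarrow> 'a measure \<Rightarrow> nat \<Rightarrow> bool" where
  "minorizes C \<nu> n \<longleftrightarrow> (\<exists>\<delta>::real. \<delta> > 0 \<and>
     (\<forall>x\<in>C. \<forall>A\<in>sets M. emeasure (kernel_pow M P n x) A \<ge> ennreal \<delta> * emeasure \<nu> A))"

lemma nn_integral_kernel_pow_ge:
  assumes x: "x \<in> space M" and f: "f \<in> borel_measurable M" and \<nu>: "sets \<nu> = sets M"
    and ge: "\<And>A. A \<in> sets M \<Longrightarrow> emeasure (kernel_pow M P n x) A \<ge> r * emeasure \<nu> A"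
  shows "(\<integral>\<^sup>+y. f y \<partial>kernel_pow M P n x) \<ge> r * (\<integral>\<^sup>+y. f y \<partial>\<nu>)"
proof -
  have "scale_measure r \<nu> \<le> kernel_pow M P n x"
    using x ge by (subst le_measure) (auto simp: sets_kernel_pow \<nu>)
  then have "(\<integral>\<^sup>+y. f y \<partial>scale_measure r \<nu>) \<le> (\<integral>\<^sup>+y. f y \<partial>kernel_pow M P n x)"
    using x by (intro nn_integral_mono_measure) (auto simp: sets_kernel_pow \<nu>)
  then show ?thesis
    using f \<nu> by (simp add: nn_integral_scale_measure cong: measurable_cong_sets)
qed

text \<open>A small set comes with an arbitrary measure. Testing the minorization on the whole space
  at one point of \<open>C\<close> bounds the total mass by the reciprocal of the constant.\<close>

lemma minorizes_finite_measure:
  assumes "minorizes C \<nu> n" "C \<noteq> {}" "C \<subseteq> space M" "sets \<nu> = sets M"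
  shows "finite_measure \<nu>"
proof
  obtain x \<delta> where x: "x \<in> C" "x \<in> space M" and \<delta>: "\<delta> > 0"
    and ge: "emeasure (kernel_pow M P n x) (space M) \<ge> ennreal \<delta> * emeasure \<nu> (space M)"
  proof -
    obtain x where "x \<in> C" using assms(2) by auto
    with assms(1,3) that show ?thesis unfolding minorizes_def by blast
  qed
  have "emeasure (kernel_pow M P n x) (space M) = 1"
    using prob_space.emeasure_space_1[OF prob_space_kernel_pow[OF x(2)]] by (simp add: space_kernel_pow x)
  with ge \<delta> have "emeasure \<nu> (space M) \<noteq> \<top>"
    by (auto simp: ennreal_mult_top top_unique)
  then show "emeasure \<nu> (space \<nu>) \<noteq> \<infinity>"
    using sets_eq_imp_space_eq[OF assms(4)] by simp
qed

text \<open>After \<open>a\<close> steps the law dominates a multiple of \<open>\<nu>\<close>; from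
  \<open>\<nu>\<close> a positive mass is in \<open>C\<close> after \<open>j\<close> more steps;
  from \<open>C\<close> the last \<open>b\<close> steps again produce a multiple of
  \<open>\<nu>\<close>.\<close>

lemma minorizes_add:
  assumes a: "minorizes C \<nu> a" and b: "minorizes C \<nu> b"
    and C: "C \<in> sets M" "C \<noteq> {}" and \<nu>: "sets \<nu> = sets M"
    and j: "(\<integral>\<^sup>+y. emeasure (kernel_pow M P j y) C \<partial>\<nu>) > 0" (is "?J > 0")
  shows "minorizes C \<nu> (a + j + b)"
proof -
  have C_sub: "C \<subseteq> space M" by (rule sets.sets_into_space[OF C(1)])
  interpret \<nu>: finite_measure \<nu>
    using minorizes_finite_measure[OF a C(2) C_sub \<nu>] .
  \<comment> \<open>The constant in \<open>minorizes\<close> is real, so the mass carried from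
    \<open>\<nu>\<close> to \<open>C\<close> has to be finite before it can enter as a
    factor.\<close>
  have "?J \<le> (\<integral>\<^sup>+y. 1 \<partial>\<nu>)"
    using prob_space_kernel_pow sets_eq_imp_space_eq[OF \<nu>]
    by (intro nn_integral_mono) (auto intro: prob_space.emeasure_le_1)
  also have "\<dots> < \<top>" by (simp add: less_top[symmetric])
  finally have J: "?J = ennreal (enn2real ?J)" by simp
  obtain \<delta>a \<delta>b where \<delta>: "\<delta>a > 0" "\<delta>b > 0"
    and ga: "\<And>x A. x \<in> C \<Longrightarrow> A \<in> sets M \<Longrightarrow> emeasure (kernel_pow M P a x) A \<ge> ennreal \<delta>a * emeasure \<nu> A"
    and gb: "\<And>x A. x \<in> C \<Longrightarrow> A \<in> sets M \<Longrightarrow> emeasure (kernel_pow M P b x) A \<ge> ennreal \<delta>b * emeasure \<nu> A"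
    using a b by (auto simp: minorizes_def)
  show ?thesis
    unfolding minorizes_def
  proof (intro exI conjI ballI)
    show "\<delta>a * enn2real ?J * \<delta>b > 0"
      using \<delta> j J by (metis enn2real_positive_iff less_top mult_pos_pos ennreal_less_top)
    fix x A assume x: "x \<in> C" and A: "A \<in> sets M"
    have xM: "x \<in> space M" using x C_sub by auto
    have "ennreal \<delta>a * ?J \<le> (\<integral>\<^sup>+y. emeasure (kernel_pow M P j y) C \<partial>kernel_pow M P a x)"
      using C xM \<nu> ga[OF x] by (intro nn_integral_kernel_pow_ge) auto
    also have "\<dots> = emeasure (kernel_pow M P (a + j) x) C"
      using C xM by (simp add: emeasure_kernel_pow_add)
    finally have "ennreal \<delta>a * ?J * (ennreal \<delta>b * emeasure \<nu> A)
        \<le> emeasure (kernel_pow M P (a + j) x) C * (ennreal \<delta>b * emeasure \<nu> A)"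
      by (intro mult_right_mono) auto
    also have "\<dots> \<le> emeasure (kernel_pow M P (a + j + b) x) A"
      using C A xM gb by (intro emeasure_kernel_pow_add_ge) auto
    finally show "ennreal (\<delta>a * enn2real ?J * \<delta>b) * emeasure \<nu> A
        \<le> emeasure (kernel_pow M P (a + j + b) x) A"
      using \<delta> by (subst (asm) J) (simp add: ennreal_mult mult_ac)
  qed
qed

end

section \<open>The occupation measure of a chain started from a measure\<close>

text \<open>This is \<open>\<nu>\<close> times the potential kernel. Its total mass is infinite for
  nonzero \<open>\<nu>\<close>; it serves only through its null sets.\<close>

definition occupation_measure ::
  "'a measure \<Rightarrow> ('a \<Rightarrow> 'a measure) \<Rightarrow> 'a measure \<Rightarrow> 'a measure" where
  "occupation_measure M P \<nu> = measure_of (space M) (sets M)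
     (\<lambda>A. \<Sum>j. \<integral>\<^sup>+y. emeasure (kernel_pow M P j y) A \<partial>\<nu>)"

lemma sets_occupation_measure [simp]: "sets (occupation_measure M P \<nu>) = sets M"
  by (simp add: occupation_measure_def)

lemma space_occupation_measure [simp]: "space (occupation_measure M P \<nu>) = space M"
  by (simp add: occupation_measure_def)

context markov_kernel
begin

lemma emeasure_occupation_measure:
  assumes \<nu>: "sets \<nu> = sets M" and A: "A \<in> sets M"
  shows "emeasure (occupation_measure M P \<nu>) A = (\<Sum>j. \<integral>\<^sup>+y. emeasure (kernel_pow M P j y) A \<partial>\<nu>)"
  unfolding occupation_measure_def
proof (rule emeasure_measure_of_sigma)
  note [measurable_cong] = \<nu>
  have sp: "space \<nu> = space M" by (rule sets_eq_imp_space_eq[OF \<nu>])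
  show "sigma_algebra (space M) (sets M)" by (rule sets.sigma_algebra_axioms)
  show "positive (sets M) (\<lambda>A. \<Sum>j. \<integral>\<^sup>+y. emeasure (kernel_pow M P j y) A \<partial>\<nu>)"
    by (simp add: positive_def)
  show "countably_additive (sets M) (\<lambda>A. \<Sum>j. \<integral>\<^sup>+y. emeasure (kernel_pow M P j y) A \<partial>\<nu>)"
  proof (rule countably_additiveI)
    fix F :: "nat \<Rightarrow> 'a set" assume F: "range F \<subseteq> sets M" "disjoint_family F"
    have "(\<Sum>i. \<Sum>j. \<integral>\<^sup>+y. emeasure (kernel_pow M P j y) (F i) \<partial>\<nu>)
        = (\<Sum>j. \<Sum>i. \<integral>\<^sup>+y. emeasure (kernel_pow M P j y) (F i) \<partial>\<nu>)"
      \<comment> \<open>The two sums are exchanged by Fubini for counting measures.\<close>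
      unfolding nn_integral_count_space_nat[symmetric]
      by (rule pair_sigma_finite.Fubini')
         (auto intro!: pair_sigma_finite.intro sigma_finite_measure_count_space)
    also have "\<dots> = (\<Sum>j. \<integral>\<^sup>+y. (\<Sum>i. emeasure (kernel_pow M P j y) (F i)) \<partial>\<nu>)"
      using F \<nu> by (intro suminf_cong nn_integral_suminf[symmetric])
        (auto cong: measurable_cong_sets)
    also have "\<dots> = (\<Sum>j. \<integral>\<^sup>+y. emeasure (kernel_pow M P j y) (\<Union>i. F i) \<partial>\<nu>)"
      using F sp by (intro suminf_cong nn_integral_cong suminf_emeasure) (auto simp: sets_kernel_pow)
    finally show "(\<Sum>i. \<Sum>j. \<integral>\<^sup>+y. emeasure (kernel_pow M P j y) (F i) \<partial>\<nu>)
        = (\<Sum>j. \<integral>\<^sup>+y. emeasure (kernel_pow M P j y) (\<Union>i. F i) \<partial>\<nu>)" .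
  qed
qed fact

lemma emeasure_occupation_measure_eq_0_iff:
  assumes \<nu>: "sets \<nu> = sets M" and A: "A \<in> sets M"
  shows "emeasure (occupation_measure M P \<nu>) A = 0 \<longleftrightarrow>
    (AE y in \<nu>. \<forall>j. emeasure (kernel_pow M P j y) A = 0)"
proof -
  have m: "(\<lambda>y. emeasure (kernel_pow M P j y) A) \<in> borel_measurable \<nu>" for j
    using A \<nu> by (simp cong: measurable_cong_sets)
  show ?thesis
    unfolding emeasure_occupation_measure[OF assms] AE_all_countable
    by (subst suminf_eq_zero_iff) (auto simp: nn_integral_0_iff_AE[OF m])
qed

end

section \<open>Maximal irreducibility and the consequences of aperiodicity\<close>

context markov_chain
begin

text \<open>If the occupation measure charges \<open>A\<close>, then every point reaches
  \<open>C\<close>, next the minorization produces a multiple of \<open>\<nu>\<close>, and from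
  there \<open>A\<close> is reached; \<open>m \<ge> 1\<close> makes the total time positive.
  Conversely, if \<open>A\<close> is null, almost no starting point under \<open>\<nu>\<close> ever
  hits \<open>A\<close>, so no irreducibility measure can charge \<open>A\<close>, as
  \<open>\<nu>\<close> is nonzero.\<close>

lemma maximal_irreducibility_occupation_measure:
  assumes C: "C \<in> sets M" and m: "m \<ge> 1" "markov_kernel.minorizes M P C \<nu> m"
    and \<nu>: "sets \<nu> = sets M" "emeasure \<nu> (space M) > 0"
    and reach: "\<And>x. x \<in> space M \<Longrightarrow> \<exists>k. emeasure (kernel_pow M P k x) C > 0"
  shows "maximal_irreducibility_measure M Pr \<Phi> (occupation_measure M P \<nu>)"
proof -
  interpret K: markov_kernel M P by (rule markov_kernel)
  let ?\<psi> = "occupation_measure M P \<nu>"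
  have sp: "space \<nu> = space M" by (rule sets_eq_imp_space_eq[OF \<nu>(1)])
  have null: "\<not> (AE y in \<nu>. False)"
    using \<nu> sp AE_iff_measurable[of "space \<nu>" \<nu> "\<lambda>_. False"] by auto
  have hits: "\<exists>k\<ge>1. emeasure (kernel_pow M P k x) A > 0"
    if A: "A \<in> sets M" and pos: "emeasure ?\<psi> A > 0" and x: "x \<in> space M" for A x
  proof -
    obtain \<epsilon> where \<epsilon>: "\<epsilon> > 0" and ge: "\<And>x A. x \<in> C \<Longrightarrow> A \<in> sets M \<Longrightarrow>
        emeasure (kernel_pow M P m x) A \<ge> ennreal \<epsilon> * emeasure \<nu> A"
      using m(2) by (auto simp: K.minorizes_def)
    from pos have "(\<Sum>j. \<integral>\<^sup>+y. emeasure (kernel_pow M P j y) A \<partial>\<nu>) \<noteq> 0"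
      using K.emeasure_occupation_measure[OF \<nu>(1) A] by simp
    then obtain j where j: "(\<integral>\<^sup>+y. emeasure (kernel_pow M P j y) A \<partial>\<nu>) \<noteq> 0"
      by (subst (asm) suminf_eq_zero_iff) auto
    obtain k where k: "emeasure (kernel_pow M P k x) C > 0" using reach[OF x] ..
    let ?r = "ennreal \<epsilon> * (\<integral>\<^sup>+y. emeasure (kernel_pow M P j y) A \<partial>\<nu>)"
    have "emeasure (kernel_pow M P (m + j) y) A \<ge> ?r" if "y \<in> C" for y
    proof -
      have "y \<in> space M" using that C sets.sets_into_space by auto
      then show ?thesis
        using A \<nu> ge[OF that] by (auto simp: K.emeasure_kernel_pow_add intro!: K.nn_integral_kernel_pow_ge)
    qed
    then have "emeasure (kernel_pow M P (k + (m + j)) x) A \<ge> emeasure (kernel_pow M P k x) C * ?r"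
      using x A C by (intro K.emeasure_kernel_pow_add_ge) auto
    moreover have "emeasure (kernel_pow M P k x) C * ?r > 0"
      using k j \<epsilon> by (simp add: zero_less_iff_neq_zero)
    ultimately show ?thesis
      using m by (intro exI[of _ "k + (m + j)"]) auto
  qed
  have irr: "irreducibility_measure M Pr \<Phi> ?\<psi>"
    unfolding irreducibility_measure_def
  proof (intro conjI ballI impI)
    show "emeasure ?\<psi> (space M) > 0"
    proof (rule ccontr)
      assume "\<not> emeasure ?\<psi> (space M) > 0"
      then have "AE y in \<nu>. \<forall>j. emeasure (kernel_pow M P j y) (space M) = 0"
        using K.emeasure_occupation_measure_eq_0_iff[OF \<nu>(1), of "space M"] by simp
      then have "AE y in \<nu>. False"
        using AE_space[of \<nu>] unfolding sp
      proof eventually_elim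
        case (elim y)
        \<comment> \<open>At time 0 the law is the point mass at \<open>y\<close>, which gives the
          whole space mass 1.\<close>
        from elim(1)[rule_format, of 0] elim(2) show False by simp
      qed
      with null show False by simp
    qed
  qed (use hits hits_iff in auto)
  have "absolutely_continuous ?\<psi> \<mu>" if \<mu>: "irreducibility_measure M Pr \<Phi> \<mu>" for \<mu>
    unfolding absolutely_continuous_def
  proof
    fix A assume "A \<in> null_sets ?\<psi>"
    then have A: "A \<in> sets M" and "emeasure ?\<psi> A = 0" by auto
    then have *: "AE y in \<nu>. \<forall>j. emeasure (kernel_pow M P j y) A = 0"
      using K.emeasure_occupation_measure_eq_0_iff[OF \<nu>(1) A] by simp
    have "emeasure \<mu> A = 0"
    proof (rule ccontr)
      assume "emeasure \<mu> A \<noteq> 0"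
      then have hit: "\<exists>k\<ge>1. emeasure (kernel_pow M P k x) A > 0" if "x \<in> space M" for x
        using \<mu> A that hits_iff[OF that A] by (auto simp: irreducibility_measure_def zero_less_iff_neq_zero)
      have "AE y in \<nu>. False"
        using * AE_space[of \<nu>] unfolding sp by eventually_elim (use hit in fastforce)
      with null show False by simp
    qed
    with A \<mu> show "A \<in> null_sets \<mu>" by (auto simp: null_sets_def irreducibility_measure_def)
  qed
  with irr show ?thesis by (simp add: maximal_irreducibility_measure_def)
qed

text \<open>The common divisor \<open>d\<close> of the shifted minorization times is shown to be the
  length of a cycle. Aperiodicity then forces \<open>d = 1\<close>, and an additive set with this
  divisor contains all large numbers.\<close>

lemma aperiodic_eventually_minorizes:
  assumes aper: "aperiodic M P Pr \<Phi>"
    and C: "C \<in> sets M" "C \<noteq> {}" and m: "m \<ge> 1" "markov_kernel.minorizes M P C \<nu> m"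
    and \<nu>: "sets \<nu> = sets M" "emeasure \<nu> (space M) > 0"
    and reach: "\<And>x. x \<in> space M \<Longrightarrow> \<exists>k. emeasure (kernel_pow M P k x) C > 0"
  shows "\<exists>n0. \<forall>n\<ge>n0. markov_kernel.minorizes M P C \<nu> n"
proof -
  interpret K: markov_kernel M P by (rule markov_kernel)
  let ?\<psi> = "occupation_measure M P \<nu>"
  let ?h = "\<lambda>n y. emeasure (kernel_pow M P n y) C"
  \<comment> \<open>These are the connecting times that \<open>minorizes_add\<close> allows between
    two minorizations.\<close>
  define J where "J = {j. (\<integral>\<^sup>+y. ?h j y \<partial>\<nu>) > 0}"
  have sp: "space \<nu> = space M" by (rule sets_eq_imp_space_eq[OF \<nu>(1)])
  have max: "maximal_irreducibility_measure M Pr \<Phi> ?\<psi>"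
    using maximal_irreducibility_occupation_measure[OF C(1) m \<nu> reach] .
  have meas_h: "?h j \<in> borel_measurable \<nu>" for j
    using C \<nu> by (simp cong: measurable_cong_sets)
  have AE_J: "AE y in \<nu>. ?h j y > 0 \<longrightarrow> j \<in> J" for j
    using nn_integral_0_iff_AE[OF meas_h, of j]
    by (cases "j \<in> J") (auto simp: J_def elim!: eventually_mono)
  have "J \<noteq> {}"
  proof
    assume "J = {}"
    then have "AE y in \<nu>. \<forall>j. \<not> ?h j y > 0"
      using AE_J by (simp add: AE_all_countable)
    then have "AE y in \<nu>. False"
      using AE_space[of \<nu>] unfolding sp by eventually_elim (use reach in blast)
    then show False
      using \<nu> sp AE_iff_measurable[of "space \<nu>" \<nu> "\<lambda>_. False"] by auto
  qed
  then obtain j0 where j0: "j0 \<in> J" by auto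
  have E_add: "K.minorizes C \<nu> (a + j + b)"
    if "K.minorizes C \<nu> a" "K.minorizes C \<nu> b" "j \<in> J" for a b j
    using K.minorizes_add[OF that(1,2) C \<nu>(1)] that(3) by (simp add: J_def)
  text \<open>Minorization times add up only with an element of \<open>J\<close> in between; the shift by \<open>j0\<close>
    absorbs it.\<close>
  define S where "S = {n + j0 | n. K.minorizes C \<nu> n}"
  have S_add: "a + b \<in> S" if ab: "a \<in> S" "b \<in> S" for a b
  proof -
    obtain a' b' where "a = a' + j0" "b = b' + j0" "K.minorizes C \<nu> a'" "K.minorizes C \<nu> b'"
      using ab by (auto simp: S_def)
    then have "a + b = (a' + j0 + b') + j0" "K.minorizes C \<nu> (a' + j0 + b')"
      using E_add j0 by auto
    then show ?thesis unfolding S_def by blast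
  qed
  have mS: "m + j0 \<in> S" "m + j0 > 0" using m by (auto simp: S_def)
  obtain d where d: "d > 0" and d_dvd: "\<And>s. s \<in> S \<Longrightarrow> d dvd s"
    and d_1: "d = 1 \<Longrightarrow> \<exists>n0. \<forall>n\<ge>n0. n \<in> S"
    using additive_set_gcd[OF S_add mS] by blast
  \<comment> \<open>Minorizing, connecting by \<open>j\<close> and minorizing again gives an element
    of \<open>S\<close>. Hence all of \<open>J\<close> lies in a single residue class modulo
    \<open>d\<close>.\<close>
  have J_dvd: "d dvd m + j + m + j0" if "j \<in> J" for j
    using d_dvd[of "(m + j + m) + j0"] E_add[OF m(2) m(2) that]
    by (auto simp: S_def)
  have J_cong: "n mod d = n' mod d" if "j + n \<in> J" "j + n' \<in> J" for j n n'
  proof -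
    have eqs: "m + (j + n) + m + j0 = n + (m + j + m + j0)" "m + (j + n') + m + j0 = n' + (m + j + m + j0)"
      by simp_all
    then have "[n + (m + j + m + j0) = n' + (m + j + m + j0)] (mod d)"
      using J_dvd[OF that(1)] J_dvd[OF that(2)] unfolding eqs cong_def dvd_eq_mod_eq_0 by simp
    then show ?thesis
      unfolding cong_add_rcancel_nat by (simp add: cong_def)
  qed
  text \<open>Points from which \<open>C\<close> is hit at times in different residue classes modulo \<open>d\<close>:
    an exceptional set that has to be removed for the remaining classes to be disjoint.\<close>
  define N where "N = {y\<in>space M. \<exists>n n'. ?h n y > 0 \<and> ?h n' y > 0 \<and> n mod d \<noteq> n' mod d}"
  have N_cong: "n mod d = n' mod d"
    if "y \<in> space M" "y \<notin> N" "?h n y > 0" "?h n' y > 0" for y n n'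
    using that unfolding N_def by blast
  have [measurable]: "C \<in> sets M" by fact
  have N [measurable]: "N \<in> sets M" unfolding N_def by measurable
  \<comment> \<open>Points are sorted by the residue of their hitting times of \<open>C\<close>,
    with opposite sign: one step shortens the time to \<open>C\<close> by one and so raises the
    index. Indices are not restricted to \<open>i < d\<close>, so that \<open>Suc i\<close> needs no
    reduction until \<open>D_eq\<close> is applied.\<close>
  define D where "D i = {y\<in>space M - N. \<exists>n. ?h n y > 0 \<and> (n + i) mod d = 0}" for i
  have D [measurable]: "D i \<in> sets M" for i unfolding D_def by measurable
  have D_eq: "D i = D i'" if "i mod d = i' mod d" for i i'
    unfolding D_def using that by (metis (no_types, lifting) mod_add_cong)
  have cycle: "is_cycle M P ?\<psi> d D"
    unfolding is_cycle_def
  proof (intro conjI allI impI ballI)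
    show "d \<ge> 1" using d by simp
    show "disjoint_family_on D {..<d}"
      unfolding disjoint_family_on_def
    proof (intro ballI impI equals0I)
      fix i k y assume ik: "i \<in> {..<d}" "k \<in> {..<d}" "i \<noteq> k" and y: "y \<in> D i \<inter> D k"
      then obtain n n' where n: "?h n y > 0" "(n + i) mod d = 0" and n': "?h n' y > 0" "(n' + k) mod d = 0"
        by (auto simp: D_def)
      have "n mod d = n' mod d" using y N_cong[OF _ _ n(1) n'(1)] by (auto simp: D_def)
      then have "(n + i) mod d = (n + k) mod d"
        using n n' by (metis mod_add_left_eq)
      then have "i mod d = k mod d"
        using cong_add_lcancel_nat[of n i k d] by (simp add: cong_def)
      with ik show False by simp
    qed
    \<comment> \<open>A hitting time \<open>n\<close> of a typical successor \<open>y\<close> gives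
      the hitting time \<open>Suc n\<close> of \<open>x\<close>. Two residues at \<open>y\<close>
      would therefore give two at \<open>x\<close>, so \<open>y\<close> avoids \<open>N\<close>; and
      the unique residue at \<open>x\<close> determines the class of \<open>y\<close>.\<close>
    show "emeasure (P x) (D (Suc i mod d)) = 1" if i: "i < d" and x: "x \<in> D i" for i x
    proof -
      have xM: "x \<in> space M" and xN: "x \<notin> N" using x by (auto simp: D_def)
      obtain n0 where n0: "?h n0 x > 0" "(n0 + i) mod d = 0" using x by (auto simp: D_def)
      have "AE y in P x. y \<in> D (Suc i)"
        using K.AE_P_hits[OF xM C(1)] AE_space[of "P x"]
        unfolding K.space_P[OF xM]
      proof eventually_elim
        case (elim y)
        have "y \<notin> N"
        proof
          assume "y \<in> N"
          then obtain n n' where n: "?h n y > 0" "?h n' y > 0" and ne: "n mod d \<noteq> n' mod d"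
            by (auto simp: N_def)
          from n elim have "?h (Suc n) x > 0" "?h (Suc n') x > 0" by auto
          moreover have "Suc n mod d \<noteq> Suc n' mod d"
            using ne cong_add_rcancel_nat[of n 1 n' d] by (simp add: cong_def)
          ultimately show False using N_cong[OF xM xN] by blast
        qed
        obtain n where n: "?h n y > 0" using reach elim by blast
        with elim have "?h (Suc n) x > 0" by auto
        with n0 have "Suc n mod d = n0 mod d" using N_cong[OF xM xN] by blast
        then have "(Suc n + i) mod d = 0"
          using n0 by (metis mod_add_left_eq)
        then have "(n + Suc i) mod d = 0" by simp
        with n \<open>y \<notin> N\<close> elim show ?case by (auto simp: D_def)
      qed
      then have "emeasure (P x) (D (Suc i)) = 1"
        using prob_space.emeasure_eq_1_AE[OF K.prob_space_P[OF xM], of "D (Suc i)"] D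
        by (simp add: K.sets_P[OF xM])
      then show ?thesis using D_eq[of "Suc i mod d" "Suc i"] by simp
    qed
    have "space M - (\<Union>i<d. D i) \<subseteq> N"
    proof
      fix y assume y: "y \<in> space M - (\<Union>i<d. D i)"
      then obtain n where n: "?h n y > 0" using reach by auto
      have "(n + (d - n mod d)) mod d = 0"
        using d by (metis le_add_diff_inverse mod_add_left_eq mod_le_divisor mod_self)
      then have "y \<in> D (d - n mod d)" if "y \<notin> N" using n y that by (auto simp: D_def)
      \<comment> \<open>The index \<open>d - n mod d\<close> equals \<open>d\<close> when
        \<open>d\<close> divides \<open>n\<close>, hence the further reduction.\<close>
      moreover have "D (d - n mod d) = D ((d - n mod d) mod d)" by (rule D_eq) simp
      ultimately show "y \<in> N" using y d mod_less_divisor by blast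
    qed
    \<comment> \<open>For almost every start under \<open>\<nu>\<close>, a typical point
      \<open>z\<close> at time \<open>j\<close> can hit \<open>C\<close> at time \<open>n\<close>
      only if \<open>j + n\<close> is in \<open>J\<close>. As \<open>J\<close> is one residue class,
      such a \<open>z\<close> has a single residue.\<close>
    moreover have "N \<in> null_sets ?\<psi>"
    proof -
      have "AE y in \<nu>. emeasure (kernel_pow M P j y) N = 0" for j
      proof -
        have "AE y in \<nu>. \<forall>n. ?h (j + n) y > 0 \<longrightarrow> j + n \<in> J"
          using AE_J by (simp add: AE_all_countable)
        then show ?thesis
          using AE_space[of \<nu>] unfolding sp
        proof eventually_elim
          case (elim y)
          let ?k = "kernel_pow M P j y"
          have y: "y \<in> space M" by fact
          have "AE z in ?k. ?h n z > 0 \<longrightarrow> j + n \<in> J" for n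
          proof (cases "j + n \<in> J")
            case False
            then have "?h (j + n) y = 0" using elim by (auto simp: zero_less_iff_neq_zero)
            then have "(\<integral>\<^sup>+z. ?h n z \<partial>?k) = 0" by (simp add: K.emeasure_kernel_pow_add y)
            then have "AE z in ?k. ?h n z = 0"
              using y by (subst (asm) nn_integral_0_iff_AE) (auto simp: K.sets_kernel_pow cong: measurable_cong_sets)
            then show ?thesis by (rule eventually_mono) auto
          qed auto
          then have "AE z in ?k. \<forall>n. ?h n z > 0 \<longrightarrow> j + n \<in> J"
            by (simp add: AE_all_countable)
          then have "AE z in ?k. z \<notin> N"
          proof (rule eventually_mono)
            fix z assume z: "\<forall>n. ?h n z > 0 \<longrightarrow> j + n \<in> J"
            show "z \<notin> N"
            proof
              assume "z \<in> N"
              then obtain n n' where "?h n z > 0" "?h n' z > 0" "n mod d \<noteq> n' mod d"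
                unfolding N_def by blast
              then show False using z J_cong[of j n n'] by blast
            qed
          qed
          then show ?case
            using N y sets.sets_into_space[OF N] by (subst (asm) AE_iff_measurable[of N])
              (auto simp: K.sets_kernel_pow K.space_kernel_pow)
        qed
      qed
      then have "emeasure ?\<psi> N = 0"
        using K.emeasure_occupation_measure_eq_0_iff[OF \<nu>(1) N] by (simp add: AE_all_countable)
      with N show ?thesis by auto
    qed
    ultimately show "space M - (\<Union>i<d. D i) \<in> null_sets ?\<psi>"
      by (rule null_sets_subset[rotated 2]) auto
  qed (rule D)
  from aper max cycle have "d = 1" by (auto simp: aperiodic_def)
  from d_1[OF this] obtain n0 where n0: "\<And>n. n \<ge> n0 \<Longrightarrow> n \<in> S" by auto
  have "K.minorizes C \<nu> n" if "n \<ge> n0" for n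
    using n0[of "n + j0"] that by (auto simp: S_def)
  then show ?thesis by blast
qed

end

section \<open>Consequences of the drift inequality\<close>

context markov_kernel
begin

text \<open>The one-step inequality is integrated against the law at each time and telescoped. The
  decrease \<open>g\<close> stands on the left, since subtraction of extended nonnegative values
  would truncate.\<close>

lemma drift_sum:
  fixes V g :: "'a \<Rightarrow> ennreal" and b :: ennreal
  assumes V: "V \<in> borel_measurable M" and g: "g \<in> borel_measurable M" and C: "C \<in> sets M"
    and drift: "\<And>x. x \<in> space M \<Longrightarrow> (\<integral>\<^sup>+y. V y \<partial>P x) + g x \<le> V x + b * indicator C x"
    and x: "x \<in> space M"
  shows "(\<integral>\<^sup>+y. V y \<partial>kernel_pow M P n x) + (\<Sum>k<n. \<integral>\<^sup>+y. g y \<partial>kernel_pow M P k x)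
    \<le> V x + b * (\<Sum>k<n. emeasure (kernel_pow M P k x) C)"
proof (induction n)
  case 0
  then show ?case using V x by (simp add: nn_integral_return)
next
  case (Suc n)
  let ?K = "\<lambda>n. kernel_pow M P n x"
  note [measurable_cong] = sets_kernel_pow[OF x]
  note [measurable] = V g C
  have "(\<integral>\<^sup>+y. V y \<partial>?K (Suc n)) + (\<integral>\<^sup>+y. g y \<partial>?K n)
      = (\<integral>\<^sup>+y. (\<integral>\<^sup>+z. V z \<partial>P y) + g y \<partial>?K n)"
    using nn_integral_kernel_pow_Suc[OF x V] nn_integral_measurable_subprob_algebra[OF V]
    by (subst nn_integral_add) (auto simp del: kernel_pow.simps)
  also have "\<dots> \<le> (\<integral>\<^sup>+y. V y + b * indicator C y \<partial>?K n)"
    using drift x by (intro nn_integral_mono) (simp add: space_kernel_pow)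
  also have "\<dots> = (\<integral>\<^sup>+y. V y \<partial>?K n) + b * emeasure (?K n) C"
    by (simp add: nn_integral_add nn_integral_cmult_indicator)
  finally have "(\<integral>\<^sup>+y. V y \<partial>?K (Suc n)) + (\<integral>\<^sup>+y. g y \<partial>?K n) + (\<Sum>k<n. \<integral>\<^sup>+y. g y \<partial>?K k)
      \<le> (\<integral>\<^sup>+y. V y \<partial>?K n) + b * emeasure (?K n) C + (\<Sum>k<n. \<integral>\<^sup>+y. g y \<partial>?K k)"
    by (rule add_right_mono)
  also have "\<dots> \<le> V x + b * (\<Sum>k<n. emeasure (?K k) C) + b * emeasure (?K n) C"
    using add_right_mono[OF Suc, of "b * emeasure (?K n) C"] by (simp add: add_ac)
  finally show ?case by (simp add: distrib_left add_ac del: kernel_pow.simps)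
qed

text \<open>If \<open>C\<close> had mass below \<open>1 / N\<close> at each of the first
  \<open>N\<close> times, its expected occupation would be at most 1, and the summed drift would
  give \<open>real N * r \<le> R' + b\<close>, against the choice of \<open>N\<close>.\<close>

lemma drift_uniform_reach:
  fixes V g :: "'a \<Rightarrow> real" and b r R :: real
  assumes V: "V \<in> borel_measurable M" and g: "g \<in> borel_measurable M" and C: "C \<in> sets M"
    and drift: "\<And>x. x \<in> space M \<Longrightarrow>
      (\<integral>\<^sup>+y. ennreal (V y) \<partial>P x) + ennreal (g x) \<le> ennreal (V x) + ennreal b * indicator C x"
    and r: "r > 0" "\<And>x. x \<in> space M \<Longrightarrow> g x \<ge> r" and b: "b \<ge> 0"
  shows "\<exists>N>0. \<forall>x\<in>space M. V x \<le> R \<longrightarrow>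
    (\<exists>k<N. emeasure (kernel_pow M P k x) C \<ge> ennreal (1 / real N))"
proof -
  define R' where "R' = max R 0"
  obtain N where "real N > (R' + b) / r" using reals_Archimedean2 by blast
  then have N: "real N * r > R' + b" using r by (simp add: pos_divide_less_eq)
  with b have "N > 0" by (intro Nat.gr0I) (auto simp: R'_def)
  moreover have "\<exists>k<N. emeasure (kernel_pow M P k x) C \<ge> ennreal (1 / real N)"
    if x: "x \<in> space M" and "V x \<le> R" for x
  proof (rule ccontr)
    assume "\<not> ?thesis"
    then have "(\<Sum>k<N. emeasure (kernel_pow M P k x) C) \<le> (\<Sum>k<N. ennreal (1 / real N))"
      by (intro sum_mono) auto
    also have "\<dots> = ennreal (\<Sum>k<N. 1 / real N)" by (rule sum_ennreal) simp
    also have "\<dots> = 1" using \<open>N > 0\<close> by simp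
    finally have le1: "(\<Sum>k<N. emeasure (kernel_pow M P k x) C) \<le> 1" .
    have "(\<integral>\<^sup>+y. ennreal (g y) \<partial>kernel_pow M P k x) \<ge> ennreal r" for k
    proof -
      have "(\<integral>\<^sup>+y. ennreal r \<partial>kernel_pow M P k x) \<le> (\<integral>\<^sup>+y. ennreal (g y) \<partial>kernel_pow M P k x)"
        using x r by (intro nn_integral_mono) (auto simp: space_kernel_pow intro: ennreal_leI)
      then show ?thesis
        using prob_space.emeasure_space_1[OF prob_space_kernel_pow[OF x, of k]] by simp
    qed
    then have "(\<Sum>k<N. ennreal r) \<le> (\<Sum>k<N. \<integral>\<^sup>+y. ennreal (g y) \<partial>kernel_pow M P k x)"
      by (intro sum_mono)
    also have "\<dots> \<le> ennreal (V x) + ennreal b * (\<Sum>k<N. emeasure (kernel_pow M P k x) C)"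
      by (rule order_trans[OF add_increasing[OF zero_le order_refl] drift_sum[OF _ _ C drift x]])
        (use V g in auto)
    also have "\<dots> \<le> ennreal R' + ennreal b * 1"
      using le1 \<open>V x \<le> R\<close> by (intro add_mono mult_left_mono ennreal_leI) (auto simp: R'_def)
    also have "\<dots> = ennreal (R' + b)" using b by (simp add: R'_def)
    finally have "ennreal (real N * r) \<le> ennreal (R' + b)"
      using r by (simp add: ennreal_mult ennreal_of_nat_eq_real_of_nat)
    then have "real N * r \<le> R' + b"
      using b by (subst (asm) ennreal_le_iff) (auto simp: R'_def)
    with N show False by simp
  qed
  ultimately show ?thesis by blast
qed

end

section \<open>Smallness of sublevel sets\<close>

context markov_chain
begin

lemma small_set_sublevel:
  fixes V g :: "'a \<Rightarrow> real" and b r R :: real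
  assumes aper: "aperiodic M P Pr \<Phi>" and small: "small_set M P C"
    and V: "V \<in> borel_measurable M" and g: "g \<in> borel_measurable M"
    and drift: "\<And>x. x \<in> space M \<Longrightarrow>
      (\<integral>\<^sup>+y. ennreal (V y) \<partial>P x) + ennreal (g x) \<le> ennreal (V x) + ennreal b * indicator C x"
    and r: "r > 0" "\<And>x. x \<in> space M \<Longrightarrow> g x \<ge> r" and b: "b \<ge> 0"
  shows "small_set M P {x\<in>space M. V x \<le> R}"
proof -
  interpret K: markov_kernel M P by (rule markov_kernel)
  obtain m \<nu> \<epsilon> where C: "C \<in> sets M" and m: "m \<ge> 1"
    and \<nu>: "sets \<nu> = sets M" "emeasure \<nu> (space M) > 0" and \<epsilon>: "\<epsilon> > 0"
    and minor: "\<forall>x\<in>C. \<forall>A\<in>sets M. emeasure (kernel_pow M P m x) A \<ge> ennreal \<epsilon> * emeasure \<nu> A"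
    using small unfolding small_set_def by blast
  have uniform: "\<exists>N>0. \<forall>x\<in>space M. V x \<le> R' \<longrightarrow>
      (\<exists>k<N. emeasure (kernel_pow M P k x) C \<ge> ennreal (1 / real N))" for R'
    by (rule K.drift_uniform_reach[OF V g C drift r b])
  have reach: "\<exists>k. emeasure (kernel_pow M P k x) C > 0" if x: "x \<in> space M" for x
  proof -
    \<comment> \<open>Each point lies in the sublevel set of its own level, so the uniform estimate
      makes \<open>C\<close> accessible from everywhere.\<close>
    from uniform[of "V x"]
    obtain N where N: "N > 0" and "\<forall>y\<in>space M. V y \<le> V x \<longrightarrow>
        (\<exists>k<N. emeasure (kernel_pow M P k y) C \<ge> ennreal (1 / real N))"
      by (elim exE conjE)
    from bspec[OF this(2) x] have "\<exists>k<N. emeasure (kernel_pow M P k x) C \<ge> ennreal (1 / real N)"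
      by simp
    then obtain k where "emeasure (kernel_pow M P k x) C \<ge> ennreal (1 / real N)"
      by (elim exE conjE)
    with N have "emeasure (kernel_pow M P k x) C > 0"
      by (auto intro: less_le_trans[of 0 "ennreal (1 / real N)"])
    then show ?thesis ..
  qed
  have "C \<noteq> {}"
  proof
    assume "C = {}"
    moreover obtain x where "x \<in> space M" using \<nu>(2) by (cases "space M = {}") auto
    ultimately show False using reach by auto
  qed
  moreover have "K.minorizes C \<nu> m"
    using \<epsilon> minor by (auto simp: K.minorizes_def)
  ultimately obtain n0 where "\<forall>n\<ge>n0. K.minorizes C \<nu> n"
    using aperiodic_eventually_minorizes[OF aper C _ m _ \<nu> reach] by blast
  then have "\<forall>n. \<exists>\<delta>::real. n \<ge> n0 \<longrightarrow> \<delta> > 0 \<and>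
      (\<forall>x\<in>C. \<forall>A\<in>sets M. emeasure (kernel_pow M P n x) A \<ge> ennreal \<delta> * emeasure \<nu> A)"
    unfolding K.minorizes_def by blast
  then obtain \<delta> :: "nat \<Rightarrow> real" where \<delta>: "\<And>n. n \<ge> n0 \<Longrightarrow> \<delta> n > 0"
    and ge: "\<And>n x A. n \<ge> n0 \<Longrightarrow> x \<in> C \<Longrightarrow> A \<in> sets M \<Longrightarrow>
      emeasure (kernel_pow M P n x) A \<ge> ennreal (\<delta> n) * emeasure \<nu> A"
    by metis
  obtain N where N: "N > 0" and hit: "\<forall>x\<in>space M. V x \<le> R \<longrightarrow>
      (\<exists>k<N. emeasure (kernel_pow M P k x) C \<ge> ennreal (1 / real N))"
    using uniform[of R] by (elim exE conjE)
  \<comment> \<open>The time \<open>k\<close> at which \<open>C\<close> is charged depends on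
    \<open>x\<close>. The remaining time to the fixed horizon \<open>n0 + N\<close> ranges over a
    finite set, so one constant serves for all of them.\<close>
  define \<eta> where "\<eta> = Min (\<delta> ` {n0..n0 + N})"
  have \<eta>: "\<eta> > 0" "\<And>n. n0 \<le> n \<Longrightarrow> n \<le> n0 + N \<Longrightarrow> \<eta> \<le> \<delta> n"
    using \<delta> by (auto simp: \<eta>_def)
  have "emeasure (kernel_pow M P (n0 + N) x) A \<ge> ennreal (1 / real N * \<eta>) * emeasure \<nu> A"
    if x: "x \<in> space M" "V x \<le> R" and A: "A \<in> sets M" for x A
  proof -
    obtain k where k: "k < N" "emeasure (kernel_pow M P k x) C \<ge> ennreal (1 / real N)"
      using bspec[OF hit x(1)] x(2) by (elim impE exE conjE)
    have "ennreal (1 / real N * \<eta>) * emeasure \<nu> A = ennreal (1 / real N) * (ennreal \<eta> * emeasure \<nu> A)"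
      using \<eta>(1) by (subst ennreal_mult) (auto simp: mult.assoc)
    also have "\<dots> \<le> emeasure (kernel_pow M P k x) C * (ennreal (\<delta> (n0 + N - k)) * emeasure \<nu> A)"
      using k \<eta>(2)[of "n0 + N - k"] by (intro mult_mono ennreal_leI) auto
    also have "\<dots> \<le> emeasure (kernel_pow M P (k + (n0 + N - k)) x) A"
      using k ge x A C by (intro K.emeasure_kernel_pow_add_ge) auto
    finally show ?thesis using k by simp
  qed
  moreover have "{x\<in>space M. V x \<le> R} \<in> sets M" using V by measurable
  ultimately show ?thesis
    unfolding small_set_def using N \<eta> \<nu>
    by (intro conjI exI[of _ "n0 + N"] exI[of _ \<nu>] exI[of _ "1 / real N * \<eta>"]) auto
qed

end

section \<open>Growth of the rate function and choice of the sampling time\<close>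

text \<open>Beyond some \<open>T\<close> the asymptotics give half the constant; on the bounded
  range below \<open>T\<close> the power is at most \<open>T powr \<eta>\<close>, and the positive
  infimum suffices.\<close>

lemma asymp_equiv_powr_lower_bound:
  fixes \<phi> :: "real \<Rightarrow> real"
  assumes asymp: "\<phi> \<sim>[at_top] (\<lambda>t. c * t powr \<eta>)" and c: "c > 0" and \<eta>: "\<eta> \<ge> 0"
    and r: "r > 0" "\<And>t. t \<ge> 1 \<Longrightarrow> \<phi> t \<ge> r"
  obtains c' where "c' > 0" "\<And>t. t \<ge> 1 \<Longrightarrow> \<phi> t \<ge> c' * t powr \<eta>"
proof -
  have "eventually (\<lambda>t. (if \<phi> t = 0 \<and> c * t powr \<eta> = 0 then 1 else \<phi> t / (c * t powr \<eta>)) > 1 / 2) at_top"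
    using asymp unfolding asymp_equiv_def by (rule order_tendstoD) simp
  moreover have "eventually (\<lambda>t::real. t > 0) at_top" by (rule eventually_gt_at_top)
  ultimately have "eventually (\<lambda>t. \<phi> t \<ge> c / 2 * t powr \<eta>) at_top"
  proof eventually_elim
    case (elim t)
    have pos: "c * t powr \<eta> > 0" using c elim by simp
    with elim have "1 / 2 < \<phi> t / (c * t powr \<eta>)" by (auto split: if_splits)
    with pos have "1 / 2 * (c * t powr \<eta>) < \<phi> t" by (simp only: pos_less_divide_eq)
    then show ?case by simp
  qed
  then obtain T' where T': "\<And>t. t \<ge> T' \<Longrightarrow> \<phi> t \<ge> c / 2 * t powr \<eta>"
    by (auto simp: eventually_at_top_linorder)
  define T where "T = max 1 T'"
  have T: "T \<ge> 1" by (simp add: T_def)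
  show ?thesis
  proof (rule that)
    show "min (c / 2) (r / T powr \<eta>) > 0" using c r T by simp
    fix t :: real assume t: "t \<ge> 1"
    show "\<phi> t \<ge> min (c / 2) (r / T powr \<eta>) * t powr \<eta>"
    proof (cases "t \<ge> T")
      case True
      have "min (c / 2) (r / T powr \<eta>) * t powr \<eta> \<le> c / 2 * t powr \<eta>"
        by (intro mult_right_mono min.cobounded1) simp
      also have "\<dots> \<le> \<phi> t" using True by (intro T') (simp add: T_def)
      finally show ?thesis .
    next
      case False
      have "min (c / 2) (r / T powr \<eta>) * t powr \<eta> \<le> r / T powr \<eta> * T powr \<eta>"
        using False t \<eta> r by (intro mult_mono powr_mono2 min.cobounded2) auto
      also have "\<dots> \<le> \<phi> t" using T r(2)[OF t] by simp
      finally show ?thesis .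
    qed
  qed
qed

text \<open>The minimum over the times from 1 to the integer part of \<open>sqrt v\<close> is at
  most the average, and dividing the total of order \<open>v\<close> by about \<open>sqrt v\<close>
  leaves order \<open>sqrt v\<close>.\<close>

lemma exists_time_le_average:
  fixes f :: "nat \<Rightarrow> ennreal" and v b c :: real
  assumes v: "v \<ge> 1" and b: "b \<ge> 0" and c: "c > 0"
    and sum: "\<And>n. (\<Sum>k<n. ennreal c * f k) \<le> ennreal v + ennreal b * of_nat n"
  shows "\<exists>n\<ge>1. real n \<le> sqrt v \<and> f n \<le> ennreal ((2 * sqrt v + 2 * b) / c)"
proof -
  define n where "n = nat \<lfloor>sqrt v\<rfloor>"
  have s: "sqrt v \<ge> 1" using v by simp
  have n: "n \<ge> 1" "real n \<le> sqrt v" "sqrt v < real n + 1"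
    unfolding n_def using s by (auto simp: le_nat_iff le_floor_iff)
  have fin: "finite (f ` {1..n})" and ne: "f ` {1..n} \<noteq> {}" using n by auto
  \<comment> \<open>Time 0 is left out because sampling times must be positive. The available sum
    starts at 0, so it is used with \<open>Suc n\<close> terms.\<close>
  obtain k where k: "k \<in> {1..n}" "f k = Min (f ` {1..n})"
    using Min_in[OF fin ne] by (metis imageE)
  have "of_nat (card {1..n}) * (ennreal c * f k) \<le> (\<Sum>i\<in>{1..n}. ennreal c * f i)"
    using k(2) Min_le[OF fin] by (intro sum_bounded_below mult_left_mono) auto
  also have "\<dots> \<le> (\<Sum>i<Suc n. ennreal c * f i)"
    by (intro sum_mono2) auto
  also have "\<dots> \<le> ennreal v + ennreal b * of_nat (Suc n)" by (rule sum)
  also have "\<dots> = ennreal (v + b * (real n + 1))"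
    using v b by (simp add: ennreal_of_nat_eq_real_of_nat ennreal_mult[symmetric] ennreal_plus[symmetric]
        add.commute del: ennreal_plus of_nat_Suc)
  finally have *: "of_nat n * (ennreal c * f k) \<le> ennreal (v + b * (real n + 1))" by simp
  have "f k \<le> ennreal ((2 * sqrt v + 2 * b) / c)"
  proof (cases "f k")
    case (real t)
    then have "ennreal (real n * (c * t)) \<le> ennreal (v + b * (real n + 1))"
      using * c by (simp add: ennreal_mult ennreal_of_nat_eq_real_of_nat)
    then have le: "real n * (c * t) \<le> v + b * (real n + 1)"
      using v b by (subst (asm) ennreal_le_iff) auto
    have n1: "real n \<ge> 1" using n(1) by simp
    \<comment> \<open>Since \<open>n \<ge> 1\<close>, rounding down costs at most a factor 2:
      \<open>sqrt v < real n + 1 \<le> 2 * real n\<close>.\<close>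
    have "v = sqrt v * sqrt v" using v by simp
    also have "\<dots> \<le> 2 * real n * sqrt v" using n(3) n1 s by (intro mult_right_mono) linarith+
    finally have "v \<le> 2 * real n * sqrt v" .
    moreover have "b * (real n + 1) \<le> b * (2 * real n)" using n1 b by (intro mult_left_mono) auto
    ultimately have "real n * (c * t) \<le> real n * (2 * sqrt v + 2 * b)"
      using le by (simp add: algebra_simps)
    then have "c * t \<le> 2 * sqrt v + 2 * b" using n by simp
    with real c show ?thesis by (simp add: pos_le_divide_eq mult.commute ennreal_leI)
  next
    case top
    with * c n have False by (auto simp: ennreal_mult_top top_unique)
    then show ?thesis ..
  qed
  with k n show ?thesis by (intro exI[of _ k]) auto
qed

section \<open>Assembly of the tameness condition\<close>

theorem proposition4p2:
  fixes M :: "'a measure" and P :: "'a \<Rightarrow> 'a measure"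
    and Pr :: "'a \<Rightarrow> 'w measure" and \<Phi> :: "nat \<Rightarrow> 'w \<Rightarrow> 'a"
    and C :: "'a set" and b :: real and V :: "'a \<Rightarrow> real"
    and \<phi> \<phi>' :: "real \<Rightarrow> real" and c \<alpha> :: real
  assumes chain: "markov_chain M P Pr \<Phi>"
    and irreducible: "phi_irreducible M Pr \<Phi>"
    and aperiodic: "aperiodic M P Pr \<Phi>"
    and small: "small_set M P C"
    and V_meas: "V \<in> borel_measurable M"
    and V_ge_1: "\<forall>x\<in>space M. V x \<ge> 1"
    and phi_pos: "\<forall>t\<ge>1. \<phi> t > 0"
    and phi_deriv: "\<forall>t\<ge>1. (\<phi> has_real_derivative \<phi>' t) (at t within {1..})"
    and phi_deriv_cont: "continuous_on {1..} \<phi>'"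
    and phi_mono: "mono_on {1..} \<phi>"
    and phi_concave: "concave_on {1..} \<phi>"
    and drift: "\<forall>x\<in>space M. (\<integral>\<^sup>+ y. ennreal (V y) \<partial>P x)
                  \<le> ennreal (V x - \<phi> (V x) + b * indicator C x)"
    and V_bdd: "bdd_above (V ` C)"
    and phi_inf: "(INF t\<in>{1..}. \<phi> t) > 0"
    and c_pos: "c > 0"
    and alpha: "0 < \<alpha>" "\<alpha> < 1 / 2"
    and phi_asymp: "\<phi> \<sim>[at_top] (\<lambda>t. c * t powr (1 - \<alpha>))"
  shows "tame M P Pr \<Phi>"
proof -
  interpret markov_chain M P Pr \<Phi> by (fact chain)
  interpret K: markov_kernel M P by (rule markov_kernel)
  define \<eta> where "\<eta> = 1 - \<alpha>"
  have \<eta>: "\<eta> > 1 / 2" "\<eta> < 1" using alpha by (auto simp: \<eta>_def)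
  have C: "C \<in> sets M" using small by (simp add: small_set_def)
  have "bdd_below (\<phi> ` {1..})"
    using phi_pos by (intro bdd_belowI2[of _ 0]) (auto intro: less_imp_le)
  then have "\<phi> t \<ge> (INF t\<in>{1..}. \<phi> t)" if "t \<ge> 1" for t
    using that by (intro cINF_lower) auto
  then obtain c' where c': "c' > 0" and phi_ge: "\<And>t. t \<ge> 1 \<Longrightarrow> \<phi> t \<ge> c' * t powr \<eta>"
    using asymp_equiv_powr_lower_bound[OF phi_asymp[folded \<eta>_def] c_pos _ phi_inf] \<eta> by auto
  define W where "W x = V x powr \<eta>" for x
  have W_meas [measurable]: "W \<in> borel_measurable M" unfolding W_def using V_meas by measurable
  have W_ge_1: "W x \<ge> 1" if "x \<in> space M" for x
    using V_ge_1 that \<eta> by (auto simp: W_def ge_one_powr_ge_zero)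
  \<comment> \<open>\<open>b\<close> may be negative, whereas the summed drift works with extended
    nonnegative numbers.\<close>
  define b' where "b' = max b 0"
  have b': "b' \<ge> 0" by (simp add: b'_def)
  have drift': "(\<integral>\<^sup>+y. ennreal (V y) \<partial>P x) + ennreal (c' * W x)
      \<le> ennreal (V x) + ennreal b' * indicator C x" if x: "x \<in> space M" for x
  proof -
    \<comment> \<open>The conversion to \<open>ennreal\<close> could hide a negative right-hand
      side. As \<open>V \<ge> 1\<close> gives an expectation of at least 1, no truncation occurs and
      \<open>\<phi> (V x)\<close> can be moved to the left.\<close>
    have "1 = (\<integral>\<^sup>+y. ennreal 1 \<partial>P x)"
      using prob_space.emeasure_space_1[OF K.prob_space_P[OF x]] by simp
    also have "\<dots> \<le> (\<integral>\<^sup>+y. ennreal (V y) \<partial>P x)"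
      using V_ge_1 x by (intro nn_integral_mono ennreal_leI) (auto simp: K.space_P)
    also have "\<dots> \<le> ennreal (V x - \<phi> (V x) + b * indicator C x)" using drift x by blast
    finally have pos: "V x - \<phi> (V x) + b * indicator C x \<ge> 1"
      by (metis ennreal_1 ennreal_le_iff2 not_one_le_zero)
    have phi: "c' * W x \<le> \<phi> (V x)" "c' * W x \<ge> 0"
      using phi_ge V_ge_1 x c' by (auto simp: W_def)
    have "(\<integral>\<^sup>+y. ennreal (V y) \<partial>P x) + ennreal (c' * W x)
        \<le> ennreal (V x - \<phi> (V x) + b * indicator C x) + ennreal (\<phi> (V x))"
      using drift x phi by (intro add_mono ennreal_leI) auto
    also have "\<dots> = ennreal (V x + b * indicator C x)"
      using pos phi by (subst ennreal_plus[symmetric]) auto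
    also have "\<dots> \<le> ennreal (V x + b' * indicator C x)"
      by (intro ennreal_leI) (auto simp: b'_def split: split_indicator)
    also have "\<dots> = ennreal (V x) + ennreal b' * indicator C x"
      using V_ge_1 x b' by (auto split: split_indicator)
    finally show ?thesis .
  qed
  \<comment> \<open>This exponent makes \<open>W x powr \<delta>\<close> equal to
    \<open>sqrt (V x)\<close>; it is below 1 because \<open>\<eta> > 1 / 2\<close>.\<close>
  define \<delta> where "\<delta> = 1 / (2 * \<eta>)"
  have \<delta>: "0 < \<delta>" "\<delta> < 1" using \<eta> by (auto simp: \<delta>_def field_simps)
  \<comment> \<open>Its logarithm lies one below the bound in condition (ii). That bound is not
    positive, so \<open>\<beta> < 1\<close>.\<close>
  define \<beta> where "\<beta> = exp (1 / \<delta> * ln (1 - \<delta>) - 1)"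
  have "1 / \<delta> * ln (1 - \<delta>) \<le> 0" using \<delta> by (intro mult_nonneg_nonpos) auto
  then have \<beta>: "0 < \<beta>" "\<beta> < 1" "ln \<beta> < 1 / \<delta> * ln (1 - \<delta>)" by (auto simp: \<beta>_def)
  have "eventually (\<lambda>v. (2 * sqrt v + 2 * b') / c' \<le> \<beta> * v powr \<eta>) at_top"
    using \<eta> \<beta> c' by real_asymp
  then obtain R where R: "\<And>v. v \<ge> R \<Longrightarrow> (2 * sqrt v + 2 * b') / c' \<le> \<beta> * v powr \<eta>"
    by (auto simp: eventually_at_top_linorder)
  \<comment> \<open>On the sublevel set no contraction is available; \<open>B\<close> bounds the
    averaged expectation there by monotonicity of the square root.\<close>
  define B where "B = (2 * sqrt R + 2 * b') / c'"
  let ?C' = "{x\<in>space M. V x \<le> R}"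
  have small': "small_set M P ?C'"
    by (rule small_set_sublevel[OF aperiodic small V_meas _ drift' c' _ b'])
      (use W_ge_1 c' in auto)
  have "\<exists>n\<ge>1. real n \<le> sqrt (V x) \<and>
      (\<integral>\<^sup>+y. ennreal (W y) \<partial>kernel_pow M P n x) \<le> ennreal ((2 * sqrt (V x) + 2 * b') / c')"
    if x: "x \<in> space M" for x
  proof (rule exists_time_le_average)
    fix n
    note [measurable_cong] = K.sets_kernel_pow[OF x]
    have "(\<Sum>k<n. ennreal c' * (\<integral>\<^sup>+y. ennreal (W y) \<partial>kernel_pow M P k x))
        = (\<Sum>k<n. \<integral>\<^sup>+y. ennreal (c' * W y) \<partial>kernel_pow M P k x)"
      using c' by (simp add: nn_integral_cmult[symmetric] ennreal_mult' )
    also have "\<dots> \<le> ennreal (V x) + ennreal b' * (\<Sum>k<n. emeasure (kernel_pow M P k x) C)"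
      by (rule order_trans[OF add_increasing[OF zero_le order_refl] K.drift_sum[OF _ _ C drift' x]])
        (use V_meas in auto)
    also have "\<dots> \<le> ennreal (V x) + ennreal b' * (\<Sum>k<n. 1)"
      using K.prob_space_kernel_pow[OF x]
      by (intro add_mono mult_left_mono sum_mono prob_space.emeasure_le_1) auto
    finally show "(\<Sum>k<n. ennreal c' * (\<integral>\<^sup>+y. ennreal (W y) \<partial>kernel_pow M P k x))
        \<le> ennreal (V x) + ennreal b' * of_nat n" by simp
  qed (use V_ge_1 x b' c' in auto)
  then obtain n where n: "\<And>x. x \<in> space M \<Longrightarrow> n x \<ge> 1" "\<And>x. x \<in> space M \<Longrightarrow> real (n x) \<le> sqrt (V x)"
    and W_le: "\<And>x. x \<in> space M \<Longrightarrow> (\<integral>\<^sup>+y. ennreal (W y) \<partial>kernel_pow M P (n x) x)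
      \<le> ennreal ((2 * sqrt (V x) + 2 * b') / c')"
    by metis
  have time: "real (n x) \<le> W x powr \<delta>" if x: "x \<in> space M" for x
  proof -
    have "W x powr \<delta> = sqrt (V x)"
      using V_ge_1 x \<eta> by (auto simp: W_def powr_powr \<delta>_def powr_half_sqrt)
    with n(2)[OF x] show ?thesis by simp
  qed
  have contraction: "(\<integral>\<^sup>+\<omega>. ennreal (W (\<Phi> (n x) \<omega>)) \<partial>Pr x) \<le> ennreal (\<beta> * W x + B * indicator ?C' x)"
    if x: "x \<in> space M" for x
  proof -
    have "(\<integral>\<^sup>+\<omega>. ennreal (W (\<Phi> (n x) \<omega>)) \<partial>Pr x) = (\<integral>\<^sup>+y. ennreal (W y) \<partial>kernel_pow M P (n x) x)"
      unfolding distr_eq_kernel_pow[OF x, symmetric]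
      using meas[OF x] by (intro nn_integral_distr[symmetric]) auto
    also have "\<dots> \<le> ennreal ((2 * sqrt (V x) + 2 * b') / c')" by (rule W_le[OF x])
    also have "\<dots> \<le> ennreal (\<beta> * W x + B * indicator ?C' x)"
    proof (intro ennreal_leI, cases "V x \<le> R")
      case True
      then have "(2 * sqrt (V x) + 2 * b') / c' \<le> B"
        unfolding B_def using c' by (intro divide_right_mono) auto
      moreover have "\<beta> * W x \<ge> 0" using \<beta> by (simp add: W_def)
      ultimately show "(2 * sqrt (V x) + 2 * b') / c' \<le> \<beta> * W x + B * indicator ?C' x"
        using True x by simp
    next
      case False
      then show "(2 * sqrt (V x) + 2 * b') / c' \<le> \<beta> * W x + B * indicator ?C' x"
        using R[of "V x"] by (simp add: W_def)
    qed
    finally show ?thesis .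
  qed
  show ?thesis
    unfolding tame_def
  proof (rule exI[of _ W], rule exI[of _ ?C'], rule exI[of _ \<beta>], rule exI[of _ B], intro conjI,
      goal_cases _ _ _ _ _ ex)
    case ex
    show ?case
      by (rule exI[of _ \<delta>], rule exI[of _ n]) (use \<beta>(3) \<delta> n(1) time contraction in blast)
  qed (simp_all add: W_meas W_ge_1 small' \<beta>(1,2))
qed

end
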